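(* Let $\mathrm{W}$ be a twice continuously differentiable elastic energy, written as a function of the Green-Lagrange strain $E=\tfrac12(F^TF-\mathbb 1)$, with second Piola-Kirchhoff stress $S_2(E)=\mathrm{D}_E\mathrm{W}(E)\in\mathrm{Sym}(3)$ and Kirchhoff stress $\tau=F\,S_2(E)\,F^T$. Let $\mathbb C=\mathrm{D}_ES_2(E)$ be the material elasticity tensor and let $\mathbb c$ be the spatial elasticity tensor, with components $$\mathbb c_{ijkl}=J^{-1}F_{iI}F_{jJ}\,\mathbb C_{IJKL}\,F_{kK}F_{lL},\qquad J=\det F .$$ Then for every motion, $$\frac{\mathrm{D}^{\mathrm{ZJ}}}{\mathrm{D}t}[\tau]=\mathbb H^{\mathrm{ZJ}}_\tau(\tau).D,\qquad \mathbb H^{\mathrm{ZJ}}_\tau(\tau)=J\,\mathbb c+\mathbb 1\,\overline{\underline{\otimes}}\,\tau+\tau\,\overline{\underline{\otimes}}\,\mathbb 1,$$ that is, in Cartesian components, $$[\mathbb H^{\mathrm{ZJ}}_\tau(\tau)]_{ijkl}=J\,\mathbb c_{ijkl}+\tfrac12(\delta_{ik}\tau_{jl}+\tau_{il}\delta_{jk})+\tfrac12(\tau_{ik}\delta_{jl}+\delta_{il}\tau_{jk}).$$ Moreover, the fourth-order tensor $\mathbb H^{\mathrm{ZJ}}_\tau(\tau)$ so defined possesses the major symmetry and both minor symmetries.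
   Context: $\mathrm{Sym}(3)$ is the space of real symmetric $3\times3$ matrices, $\mathbb 1$ is the identity matrix with components $\delta_{ij}$. Cartesian coordinates and the summation convention over repeated indices are used. The energy $\mathrm{W}$ is defined on the open set of $E\in\mathrm{Sym}(3)$ with $\mathbb 1+2E$ positive definite; $\mathrm{D}_E$ denotes the Fréchet derivative with respect to $E$. The tensor $\mathbb C=\mathrm{D}_ES_2(E)$, a linear map on $\mathrm{Sym}(3)$, is identified with the fourth-order tensor $\mathbb C_{IJKL}$ having both minor symmetries (i.e. it is extended to all $3\times3$ matrices by $\mathbb C.X=\mathbb C.\tfrac12(X+X^T)$). A motion is represented at a material point by a $C^1$ curve $t\mapsto F(t)$ of real $3\times3$ matrices with $\det F(t)>0$; a dot or $\frac{\mathrm D}{\mathrm Dt}$ denotes the derivative along the curve. $L=\dot F F^{-1}$, $D=\tfrac12(L+L^T)$, $W=\tfrac12(L-L^T)$ (not to be confused with the energy $\mathrm W$). The Zaremba-Jaumann rate of $\tau$ is $\frac{\mathrm{D}^{\mathrm{ZJ}}}{\mathrm{D}t}[\tau]=\frac{\mathrm D}{\mathrm Dt}[\tau]+\tau W-W\tau$. The action of a fourth-order tensor is $(\mathbb T.Z)_{ij}=\mathbb T_{ijkl}Z_{kl}$. For second-order tensors $P,Q$ the product $P\,\overline{\underline{\otimes}}\,Q$ is defined by $$(P\,\overline{\underline{\otimes}}\,Q)_{ijkl}=\tfrac12\,(P_{ik}Q_{jl}+Q_{il}P_{jk}).$$ Minor symmetries of $\mathbb T$: $\mathbb T_{ijkl}=\mathbb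 T_{jikl}$ (left) and $\mathbb T_{ijkl}=\mathbb T_{ijlk}$ (right). Major symmetry: $\mathbb T_{ijkl}=\mathbb T_{klij}$. *)

theory Defs
  imports "HOL-Analysis.Analysis"
begin

type_synonym mat3 = "real^3^3"

text \<open>Fourth-order tensors: \<open>\<T> $ i $ j $ k $ l\<close> is the Cartesian component \<open>\<T>\<^sub>i\<^sub>j\<^sub>k\<^sub>l\<close>.\<close>

type_synonym tensor4 = "real^3^3^3^3"

definition tensor_act :: "tensor4 \<Rightarrow> mat3 \<Rightarrow> mat3" where
  "tensor_act \<T> Z = (\<chi> i j. \<Sum>k\<in>UNIV. \<Sum>l\<in>UNIV. \<T> $ i $ j $ k $ l * Z $ k $ l)"

definition sym_tprod :: "mat3 \<Rightarrow> mat3 \<Rightarrow> tensor4" where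
  "sym_tprod P Q = (\<chi> i j k l. (P $ i $ k * Q $ j $ l + Q $ i $ l * P $ j $ k) / 2)"

definition left_minor_symmetric :: "tensor4 \<Rightarrow> bool" where
  "left_minor_symmetric \<T> \<longleftrightarrow> (\<forall>i j k l. \<T> $ i $ j $ k $ l = \<T> $ j $ i $ k $ l)"

definition right_minor_symmetric :: "tensor4 \<Rightarrow> bool" where
  "right_minor_symmetric \<T> \<longleftrightarrow> (\<forall>i j k l. \<T> $ i $ j $ k $ l = \<T> $ i $ j $ l $ k)"

definition major_symmetric :: "tensor4 \<Rightarrow> bool" where
  "major_symmetric \<T> \<longleftrightarrow> (\<forall>i j k l. \<T> $ i $ j $ k $ l = \<T> $ k $ l $ i $ j)"

definition sym_part :: "mat3 \<Rightarrow> mat3" where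
  "sym_part X = (1/2) *\<^sub>R (X + transpose X)"

definition skew_part :: "mat3 \<Rightarrow> mat3" where
  "skew_part X = (1/2) *\<^sub>R (X - transpose X)"

definition Sym3 :: "mat3 set" where
  "Sym3 = {A. transpose A = A}"

definition strain_dom :: "mat3 set" where
  "strain_dom = {E \<in> Sym3. \<forall>x. x \<noteq> 0 \<longrightarrow> x \<bullet> ((mat 1 + 2 *\<^sub>R E) *v x) > 0}"

text \<open>
  \<^const>\<open>strain_dom\<close> is relatively open in the subspace \<^const>\<open>Sym3\<close>. The Frechet derivative on
  \<^const>\<open>Sym3\<close> is therefore the derivative \<open>at E within strain_dom\<close>, which determines a linear map
  only on \<^const>\<open>Sym3\<close>; its values on non-symmetric matrices are irrelevant.
\<close>

definition twice_continuously_differentiable_on ::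
    "('a::real_normed_vector \<Rightarrow> 'b::real_normed_vector) \<Rightarrow> 'a set \<Rightarrow> bool" where
  "twice_continuously_differentiable_on f S \<longleftrightarrow>
     (\<exists>(f' :: 'a \<Rightarrow> 'a \<Rightarrow>\<^sub>L 'b) (f'' :: 'a \<Rightarrow> 'a \<Rightarrow>\<^sub>L ('a \<Rightarrow>\<^sub>L 'b)).
        (\<forall>x\<in>S. (f has_derivative blinfun_apply (f' x)) (at x within S)) \<and>
        (\<forall>x\<in>S. (f' has_derivative blinfun_apply (f'' x)) (at x within S)) \<and>
        continuous_on S f'')"

text \<open>
  \<open>S\<^sub>2(E)\<close> is the derivative of the energy, identified with a symmetric matrix through the inner
  product \<open>A \<bullet> B = tr (A B\<^sup>T)\<close>. The last conjunct in the definition of \<open>material_elasticity\<close> is the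
  extension of \<open>D\<^sub>E S\<^sub>2(E)\<close> from symmetric to arbitrary matrices.
\<close>

definition PK2_stress :: "(mat3 \<Rightarrow> real) \<Rightarrow> mat3 \<Rightarrow> mat3" where
  "PK2_stress W E = (THE S. S \<in> Sym3 \<and> (W has_derivative (\<lambda>H. S \<bullet> H)) (at E within strain_dom))"

definition material_elasticity :: "(mat3 \<Rightarrow> real) \<Rightarrow> mat3 \<Rightarrow> tensor4" where
  "material_elasticity W E =
     (THE \<C>. (PK2_stress W has_derivative tensor_act \<C>) (at E within strain_dom) \<and>
             (\<forall>X. tensor_act \<C> X = tensor_act \<C> (sym_part X)))"

definition green_lagrange :: "mat3 \<Rightarrow> mat3" where
  "green_lagrange F = (1/2) *\<^sub>R (transpose F ** F - mat 1)"

definition kirchhoff_stress :: "(mat3 \<Rightarrow> real) \<Rightarrow> mat3 \<Rightarrow> mat3" where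
  "kirchhoff_stress W F = F ** PK2_stress W (green_lagrange F) ** transpose F"

definition spatial_elasticity :: "(mat3 \<Rightarrow> real) \<Rightarrow> mat3 \<Rightarrow> tensor4" where
  "spatial_elasticity W F =
     (\<chi> i j k l. inverse (det F) *
        (\<Sum>I\<in>UNIV. \<Sum>J\<in>UNIV. \<Sum>K\<in>UNIV. \<Sum>L\<in>UNIV.
           F $ i $ I * F $ j $ J * material_elasticity W (green_lagrange F) $ I $ J $ K $ L
             * F $ k $ K * F $ l $ L))"

definition ZJ_stiffness :: "(mat3 \<Rightarrow> real) \<Rightarrow> mat3 \<Rightarrow> tensor4" where
  "ZJ_stiffness W F =
     det F *\<^sub>R spatial_elasticity W F
       + sym_tprod (mat 1) (kirchhoff_stress W F) + sym_tprod (kirchhoff_stress W F) (mat 1)"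

definition is_motion_on :: "real set \<Rightarrow> (real \<Rightarrow> mat3) \<Rightarrow> bool" where
  "is_motion_on T F \<longleftrightarrow> open T \<and> F C1_differentiable_on T \<and> (\<forall>t\<in>T. det (F t) > 0)"

definition velocity_gradient :: "(real \<Rightarrow> mat3) \<Rightarrow> real \<Rightarrow> mat3" where
  "velocity_gradient F t = vector_derivative F (at t) ** matrix_inv (F t)"

definition stretching :: "(real \<Rightarrow> mat3) \<Rightarrow> real \<Rightarrow> mat3" where
  "stretching F t = sym_part (velocity_gradient F t)"

definition vorticity :: "(real \<Rightarrow> mat3) \<Rightarrow> real \<Rightarrow> mat3" where
  "vorticity F t = skew_part (velocity_gradient F t)"

definition ZJ_rate :: "(real \<Rightarrow> mat3) \<Rightarrow> (real \<Rightarrow> mat3) \<Rightarrow> real \<Rightarrow> mat3" where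
  "ZJ_rate F \<tau> t = vector_derivative \<tau> (at t) + \<tau> t ** vorticity F t - vorticity F t ** \<tau> t"

end

theory Submission
  imports Defs
begin

text \<open>
  The function \<open>X \<mapsto> W (sym_part X)\<close> is twice differentiable on an open subset of the space of all
  matrices, where derivatives are unique. Its gradient and second derivative at \<open>E\<close> are \<open>S\<^sub>2(E)\<close>
  and \<open>\<C>\<close>, so the symmetry of second derivatives gives the major symmetry of \<open>\<C>\<close>. With
  \<open>F' = L F\<close> and \<open>E' = F\<^sup>T D F\<close>, the product rule gives
  \<open>\<tau>' = L \<tau> + \<tau> L\<^sup>T + F (\<C>.(F\<^sup>T D F)) F\<^sup>T\<close>; the spin cancels in the Zaremba-Jaumann rate, which
  leaves \<open>D \<tau> + \<tau> D + J c.D\<close>.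
\<close>

section \<open>Symmetry of second derivatives\<close>

text \<open>
  The second difference of \<open>f\<close> is symmetric in \<open>u\<close> and \<open>v\<close> and, by the mean value theorem along \<open>v\<close>,
  equals \<open>s\<^sup>2 (G u \<bullet> v) + o(s\<^sup>2)\<close>.
\<close>

lemma second_derivative_symmetric:
  fixes f :: "'a::real_inner \<Rightarrow> real"
  assumes "open U" "x \<in> U"
    and f: "\<And>y. y \<in> U \<Longrightarrow> (f has_derivative (\<lambda>h. g y \<bullet> h)) (at y)"
    and g: "(g has_derivative G) (at x)"
  shows "G u \<bullet> v = G v \<bullet> u"
proof -
  define \<Delta> where "\<Delta> u v s = f (x + s *\<^sub>R u + s *\<^sub>R v) - f (x + s *\<^sub>R u) - f (x + s *\<^sub>R v) + f x"
    for u v s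
  interpret G: bounded_linear G
    using g by (rule has_derivative_bounded_linear)
  obtain r where "r > 0" and r: "ball x r \<subseteq> U"
    using assms openE by blast
  have second_difference: "\<exists>d>0. \<forall>s. 0 < s \<longrightarrow> s < d \<longrightarrow> \<bar>\<Delta> u v s - s\<^sup>2 * (G u \<bullet> v)\<bar> \<le> e * s\<^sup>2"
    if "e > 0" for u v e
  proof -
    \<comment> \<open>\<open>K\<close> bounds the parallelogram: \<open>a u + b v\<close> has norm
      at most \<open>s * K\<close> for \<open>a\<close>, \<open>b\<close> in [0, s]. The summand 1
      keeps \<open>K\<close> positive when \<open>u = v = 0\<close>.\<close>
    define K where "K = norm u + norm v + 1"
    have "K > 0" by (simp add: K_def add_nonneg_pos)
    \<comment> \<open>Two remainders of size at most \<open>e' * (s * K)\<close> will be paired with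
      \<open>v\<close>, whose norm is at most \<open>K\<close>, and multiplied by \<open>s\<close>;
      this choice makes the total exactly \<open>e * s\<^sup>2\<close>.\<close>
    define e' where "e' = e / (2 * K\<^sup>2)"
    have "e' > 0" using \<open>e > 0\<close> \<open>K > 0\<close> by (simp add: e'_def)
    then obtain d where "d > 0"
      and d: "\<And>y. norm (y - x) < d \<Longrightarrow> norm (g y - g x - G (y - x)) \<le> e' * norm (y - x)"
      using g unfolding has_derivative_at_alt by blast
    \<comment> \<open>Below this bound \<open>s * K < d\<close> makes the expansion of
      \<open>g\<close> at \<open>x\<close> available, and \<open>s * K < r\<close> keeps the
      parallelogram inside \<open>U\<close>.\<close>
    have "\<bar>\<Delta> u v s - s\<^sup>2 * (G u \<bullet> v)\<bar> \<le> e * s\<^sup>2" if s: "0 < s" "s < min d r / K" for s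
    proof -
      have sK: "s * K < d" "s * K < r"
        using s \<open>K > 0\<close> by (auto simp: field_simps)
      have small: "norm (a *\<^sub>R u + b *\<^sub>R v) \<le> s * K" if "0 \<le> a" "a \<le> s" "0 \<le> b" "b \<le> s" for a b
      proof -
        have "norm (a *\<^sub>R u + b *\<^sub>R v) \<le> a * norm u + b * norm v"
          using that norm_triangle_ineq[of "a *\<^sub>R u" "b *\<^sub>R v"] by simp
        also have "\<dots> \<le> s * norm u + s * norm v"
          using that by (intro add_mono mult_right_mono) auto
        also have "\<dots> \<le> s * K"
          using s by (simp add: K_def algebra_simps)
        finally show ?thesis .
      qed
      have in_U: "x + (a *\<^sub>R u + b *\<^sub>R v) \<in> U" if "0 \<le> a" "a \<le> s" "0 \<le> b" "b \<le> s" for a b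
        using small[OF that] sK
        by (intro r[THEN subsetD], subst mem_ball, subst dist_commute) (simp add: dist_norm)
      \<comment> \<open>The increment of \<open>\<phi>\<close> from 0 to \<open>s\<close> is the
        second difference. Keeping the term \<open>0 *\<^sub>R u\<close> lets \<open>line\<close>
        apply to both summands, with \<open>a = s\<close> and \<open>a = 0\<close>.\<close>
      define \<phi> where "\<phi> \<rho> = f (x + (s *\<^sub>R u + \<rho> *\<^sub>R v)) - f (x + (0 *\<^sub>R u + \<rho> *\<^sub>R v))" for \<rho>
      have line: "((\<lambda>\<rho>. f (x + (a *\<^sub>R u + \<rho> *\<^sub>R v))) has_real_derivative
          g (x + (a *\<^sub>R u + b *\<^sub>R v)) \<bullet> v) (at b)"
        if "0 \<le> a" "a \<le> s" "0 \<le> b" "b \<le> s" for a b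
      proof -
        have "((\<lambda>\<rho>. x + (a *\<^sub>R u + \<rho> *\<^sub>R v)) has_derivative (\<lambda>h. h *\<^sub>R v)) (at b)"
          by (auto intro!: derivative_eq_intros)
        from has_derivative_compose[OF this f[OF in_U[OF that]]]
        show ?thesis
          by (rule has_derivative_imp_has_field_derivative) simp
      qed
      have "DERIV \<phi> b :> g (x + (s *\<^sub>R u + b *\<^sub>R v)) \<bullet> v - g (x + (0 *\<^sub>R u + b *\<^sub>R v)) \<bullet> v"
        if "0 \<le> b" "b \<le> s" for b
        unfolding \<phi>_def using that s by (intro DERIV_diff line) auto
      from MVT2[OF \<open>0 < s\<close> this]
      obtain \<xi> where \<xi>: "0 < \<xi>" "\<xi> < s"
        and mvt: "\<phi> s - \<phi> 0 = s * (g (x + (s *\<^sub>R u + \<xi> *\<^sub>R v)) \<bullet> v - g (x + (0 *\<^sub>R u + \<xi> *\<^sub>R v)) \<bullet> v)"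
        by auto
      \<comment> \<open>The remainder of the first-order expansion of \<open>g\<close> at
        \<open>x\<close>. In \<open>R s - R 0\<close> the contributions of \<open>g x\<close> and of
        \<open>\<xi> v\<close> cancel, so the difference of gradients is
        \<open>s *\<^sub>R G u + (R s - R 0)\<close>.\<close>
      define R where "R a = g (x + (a *\<^sub>R u + \<xi> *\<^sub>R v)) - g x - G (a *\<^sub>R u + \<xi> *\<^sub>R v)" for a
      have R: "norm (R a) \<le> e' * (s * K)" if "0 \<le> a" "a \<le> s" for a
      proof -
        have n: "norm (a *\<^sub>R u + \<xi> *\<^sub>R v) \<le> s * K"
          using small that \<xi> by auto
        then have "norm (R a) \<le> e' * norm (a *\<^sub>R u + \<xi> *\<^sub>R v)"
          using d[of "x + (a *\<^sub>R u + \<xi> *\<^sub>R v)"] sK by (simp add: R_def)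
        also have "\<dots> \<le> e' * (s * K)"
          using n \<open>e' > 0\<close> by simp
        finally show ?thesis .
      qed
      have "\<Delta> u v s = \<phi> s - \<phi> 0"
        by (simp add: \<Delta>_def \<phi>_def add.assoc)
      also have "\<dots> = s * ((s *\<^sub>R G u + (R s - R 0)) \<bullet> v)"
        unfolding mvt by (simp add: R_def G.add G.scaleR inner_simps algebra_simps)
      finally have "\<Delta> u v s - s\<^sup>2 * (G u \<bullet> v) = s * ((R s - R 0) \<bullet> v)"
        by (simp add: inner_simps algebra_simps power2_eq_square)
      then have "\<bar>\<Delta> u v s - s\<^sup>2 * (G u \<bullet> v)\<bar> = s * \<bar>(R s - R 0) \<bullet> v\<bar>"
        using s by (simp add: abs_mult)
      also have "\<dots> \<le> s * (norm (R s - R 0) * norm v)"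
        using s by (intro mult_left_mono Cauchy_Schwarz_ineq2) auto
      also have "\<dots> \<le> s * ((2 * (e' * (s * K))) * K)"
        using s R[of s] R[of 0] norm_triangle_ineq4[of "R s" "R 0"] norm_ge_zero[of "R 0"]
        by (intro mult_left_mono mult_mono) (auto simp: K_def intro: order_trans[OF norm_ge_zero])
      also have "\<dots> = e * s\<^sup>2"
        using \<open>K > 0\<close> by (simp add: e'_def field_simps power2_eq_square)
      finally show ?thesis .
    qed
    then show ?thesis
      using \<open>K > 0\<close> \<open>d > 0\<close> \<open>r > 0\<close> by (intro exI[of _ "min d r / K"]) auto
  qed
  \<comment> \<open>One number, \<open>\<Delta> u v s = \<Delta> v u s\<close>, approximates both
    \<open>s\<^sup>2 * (G u \<bullet> v)\<close> and \<open>s\<^sup>2 * (G v \<bullet> u)\<close>.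
    Each error is given half of \<open>e\<close>, and \<open>s\<^sup>2\<close> is divided
    out.\<close>
  have "\<bar>G u \<bullet> v - G v \<bullet> u\<bar> \<le> 0 + e" if "e > 0" for e
  proof -
    obtain d1 where "d1 > 0"
      and d1: "\<And>s. 0 < s \<Longrightarrow> s < d1 \<Longrightarrow> \<bar>\<Delta> u v s - s\<^sup>2 * (G u \<bullet> v)\<bar> \<le> e / 2 * s\<^sup>2"
      using second_difference[of "e / 2" u v] \<open>e > 0\<close> by auto
    obtain d2 where "d2 > 0"
      and d2: "\<And>s. 0 < s \<Longrightarrow> s < d2 \<Longrightarrow> \<bar>\<Delta> v u s - s\<^sup>2 * (G v \<bullet> u)\<bar> \<le> e / 2 * s\<^sup>2"
      using second_difference[of "e / 2" v u] \<open>e > 0\<close> by auto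
    define s where "s = min d1 d2 / 2"
    have s: "0 < s" "s < d1" "s < d2"
      using \<open>d1 > 0\<close> \<open>d2 > 0\<close> by (auto simp: s_def)
    have "\<Delta> u v s = \<Delta> v u s"
      by (simp add: \<Delta>_def add.assoc add.commute add.left_commute)
    then have "\<bar>s\<^sup>2 * (G u \<bullet> v) - s\<^sup>2 * (G v \<bullet> u)\<bar> \<le> e * s\<^sup>2"
      using d1[OF s(1,2)] d2[OF s(1,3)] by linarith
    then have "s\<^sup>2 * \<bar>G u \<bullet> v - G v \<bullet> u\<bar> \<le> s\<^sup>2 * e"
      by (simp only: right_diff_distrib[symmetric] abs_mult abs_power2 mult.commute[of e])
    then show ?thesis
      using s by simp
  qed
  then have "\<bar>G u \<bullet> v - G v \<bullet> u\<bar> \<le> 0"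
    by (rule field_le_epsilon)
  then show ?thesis by simp
qed

section \<open>Continuity of matrix operations and openness of positive definiteness\<close>

lemma bounded_bilinear_matrix_vector_mult:
  "bounded_bilinear ((*v) :: real^'n^'m \<Rightarrow> real^'n \<Rightarrow> real^'m)"
  unfolding bilinear_conv_bounded_bilinear[symmetric] bilinear_def
  by (auto intro!: linearI simp: matrix_vector_mult_def vec_eq_iff algebra_simps sum.distrib sum_distrib_left)

lemma bounded_bilinear_matrix_matrix_mult:
  "bounded_bilinear ((**) :: real^'n^'m \<Rightarrow> real^'k^'n \<Rightarrow> real^'k^'m)"
  unfolding bilinear_conv_bounded_bilinear[symmetric] bilinear_def
  by (auto intro!: linearI simp: matrix_matrix_mult_def vec_eq_iff algebra_simps sum.distrib sum_distrib_left)

lemma bounded_linear_transpose: "bounded_linear (transpose :: real^'n^'m \<Rightarrow> real^'m^'n)"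
  unfolding linear_conv_bounded_linear[symmetric]
  by (auto intro!: linearI simp: transpose_def vec_eq_iff)

lemma bounded_linear_sym_part: "bounded_linear sym_part"
  unfolding sym_part_def
  by (intro bounded_linear_intros bounded_linear_transpose)

text \<open>By compactness the quadratic form of \<open>A\<close> has a positive minimum
  \<open>c\<close> on the unit sphere. A perturbation of norm below \<open>c / K\<close> changes the
  form there by less than \<open>c\<close>, and homogeneity carries positivity to all nonzero
  vectors.\<close>

lemma open_positive_definite:
  "open {A :: real^'n^'n. \<forall>x. x \<noteq> 0 \<longrightarrow> x \<bullet> (A *v x) > 0}"
proof (rule openI, clarify)
  fix A :: "real^'n^'n"
  assume A: "\<forall>x. x \<noteq> 0 \<longrightarrow> x \<bullet> (A *v x) > 0"
  interpret bounded_bilinear "(*v) :: real^'n^'n \<Rightarrow> real^'n \<Rightarrow> real^'n"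
    by (rule bounded_bilinear_matrix_vector_mult)
  obtain K where "K > 0" and K: "\<And>(M :: real^'n^'n) x. norm (M *v x) \<le> norm M * norm x * K"
    using pos_bounded by blast
  have "continuous_on (sphere 0 1) (\<lambda>x. x \<bullet> (A *v x))"
    by (intro continuous_intros continuous_on)
  then obtain z where z: "z \<in> sphere 0 1"
    and min: "\<And>x. x \<in> sphere 0 1 \<Longrightarrow> z \<bullet> (A *v z) \<le> x \<bullet> (A *v x)"
    using continuous_attains_inf[of "sphere 0 1" "\<lambda>x. x \<bullet> (A *v x)"] by auto
  define c where "c = z \<bullet> (A *v z)"
  have "z \<noteq> 0"
    using z by auto
  then have "c > 0"
    using A by (simp add: c_def)
  have "x \<bullet> (B *v x) > 0" if B: "B \<in> ball A (c / K)" and "x \<noteq> 0" for B x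
  proof -
    define y where "y = (1 / norm x) *\<^sub>R x"
    have "norm y = 1" and x: "x = norm x *\<^sub>R y"
      using \<open>x \<noteq> 0\<close> by (auto simp: y_def)
    have "\<bar>y \<bullet> ((A - B) *v y)\<bar> \<le> norm (A - B) * K"
      using Cauchy_Schwarz_ineq2[of y "(A - B) *v y"] K[of "A - B" y] \<open>norm y = 1\<close> by simp
    also have "\<dots> < c"
      using B \<open>K > 0\<close> by (simp add: dist_norm field_simps)
    also have "c \<le> y \<bullet> (A *v y)"
      using min[of y] \<open>norm y = 1\<close> by (simp add: c_def)
    finally have "y \<bullet> (B *v y) > 0"
      by (simp add: diff_left inner_diff_right)
    then show ?thesis
      using \<open>x \<noteq> 0\<close> by (subst (1 2) x) (simp add: scaleR_right)
  qed
  then show "\<exists>e>0. ball A e \<subseteq> {A. \<forall>x. x \<noteq> 0 \<longrightarrow> x \<bullet> (A *v x) > 0}"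
    using \<open>c > 0\<close> \<open>K > 0\<close> by (intro exI[of _ "c / K"]) auto
qed

section \<open>Extension of functions from \<open>strain_dom\<close> to all matrices by
  \<open>sym_part\<close>\<close>

lemma sym_part_in_Sym3 [simp]: "sym_part X \<in> Sym3"
  by (simp add: sym_part_def Sym3_def transpose_def vec_eq_iff add.commute)

lemma sym_part_Sym3: "X \<in> Sym3 \<Longrightarrow> sym_part X = X"
  by (simp add: sym_part_def Sym3_def scaleR_2[symmetric])

text \<open>\<open>strain_dom\<close> lies in a proper subspace and so has empty interior among all
  matrices. Its preimage under \<open>sym_part\<close> is open, so derivatives there are
  unrestricted and unique.\<close>

lemma open_sym_part_vimage_strain_dom: "open (sym_part -` strain_dom)"
proof -
  have "sym_part -` strain_dom =
      (\<lambda>X. mat 1 + 2 *\<^sub>R sym_part X) -` {A. \<forall>x. x \<noteq> 0 \<longrightarrow> x \<bullet> (A *v x) > 0}"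
    by (auto simp: strain_dom_def)
  then show ?thesis
    using continuous_on_open_vimage[of UNIV "\<lambda>X. mat 1 + 2 *\<^sub>R sym_part X"] open_positive_definite
    by (auto intro!: continuous_intros bounded_linear.continuous_on[OF bounded_linear_sym_part])
qed

lemma inner_transpose: "transpose A \<bullet> B = A \<bullet> transpose (B :: real^'n^'m)"
  by (simp add: inner_vec_def transpose_def) (rule sum.swap)

lemma sym_part_inner: "sym_part A \<bullet> B = A \<bullet> sym_part B"
  by (simp add: sym_part_def inner_simps inner_transpose)

lemma sym_part_idem [simp]: "sym_part (sym_part X) = sym_part X"
  by (simp add: sym_part_Sym3)

lemma Sym3_iff_sym_part: "X \<in> Sym3 \<longleftrightarrow> sym_part X = X"
  by (metis sym_part_Sym3 sym_part_in_Sym3)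

lemma strain_dom_subset_Sym3: "E \<in> strain_dom \<Longrightarrow> E \<in> Sym3"
  by (simp add: strain_dom_def)

text \<open>The coordinates of the representing vector in the orthonormal basis are the values of
  \<open>L\<close> on that basis. This turns derivative functionals of the energy into
  matrices.\<close>

lemma riesz_inner:
  fixes L :: "'a::euclidean_space \<Rightarrow> real"
  assumes "linear L"
  shows "(\<Sum>b\<in>Basis. L b *\<^sub>R b) \<bullet> h = L h"
proof -
  interpret linear L by fact
  have "L h = L (\<Sum>b\<in>Basis. (h \<bullet> b) *\<^sub>R b)"
    by (simp add: euclidean_representation)
  also have "\<dots> = (\<Sum>b\<in>Basis. L b *\<^sub>R b) \<bullet> h"
    by (simp add: sum scale inner_sum_left inner_commute[of h] mult.commute)
  finally show ?thesis by simp
qed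

text \<open>The chain rule, since \<open>sym_part\<close> is linear and maps the open preimage into
  \<open>strain_dom\<close>; openness then removes the restriction on the derivative. With
  \<open>has_derivative_within_strain_dom\<close>, which goes back by restriction, it links relative
  and full derivatives.\<close>

lemma has_derivative_sym_part_comp:
  assumes X: "sym_part X \<in> strain_dom"
    and \<Phi>: "(\<Phi> has_derivative \<Phi>') (at (sym_part X) within strain_dom)"
  shows "((\<lambda>X. \<Phi> (sym_part X)) has_derivative (\<lambda>H. \<Phi>' (sym_part H))) (at X)"
proof -
  let ?U = "sym_part -` strain_dom"
  have "(sym_part has_derivative sym_part) (at X within ?U)"
    by (rule bounded_linear.has_derivative[OF bounded_linear_sym_part has_derivative_ident])
  moreover have "(\<Phi> has_derivative \<Phi>') (at (sym_part X) within sym_part ` ?U)"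
    using \<Phi> by (rule has_derivative_subset) auto
  ultimately have "((\<lambda>X. \<Phi> (sym_part X)) has_derivative (\<lambda>H. \<Phi>' (sym_part H))) (at X within ?U)"
    by (rule has_derivative_in_compose)
  then show ?thesis
    using at_within_open[OF _ open_sym_part_vimage_strain_dom, of X] X by simp
qed

lemma has_derivative_within_strain_dom:
  assumes "E \<in> strain_dom" "(\<Psi> has_derivative \<Phi>') (at E)"
    and "\<And>E. E \<in> strain_dom \<Longrightarrow> \<Psi> E = \<Phi> E"
  shows "(\<Phi> has_derivative \<Phi>') (at E within strain_dom)"
  using has_derivative_at_withinI[OF assms(2)] assms(1,3)
  by (rule has_derivative_transform_within[OF _ zero_less_one]) auto

text \<open>The Riesz sum over \<open>Basis\<close> turns the functionals \<open>W'\<close> into the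
  matrix field \<open>g\<close>, which is differentiated summand by summand. The inserted
  \<open>sym_part\<close> makes \<open>g X \<bullet> H\<close> and \<open>G X H\<close> blind to the
  skew part of \<open>H\<close>.\<close>

lemma elastic_potential:
  fixes W :: "mat3 \<Rightarrow> real"
  assumes "twice_continuously_differentiable_on W strain_dom"
  obtains g :: "mat3 \<Rightarrow> mat3" and G :: "mat3 \<Rightarrow> mat3 \<Rightarrow> mat3" where
    "\<And>X. sym_part X \<in> strain_dom \<Longrightarrow> ((\<lambda>X. W (sym_part X)) has_derivative (\<lambda>H. g X \<bullet> H)) (at X)"
    "\<And>X. sym_part X \<in> strain_dom \<Longrightarrow> (g has_derivative G X) (at X)"
    "\<And>X. g X \<in> Sym3"
    "\<And>X H. G X (sym_part H) = G X H"
proof -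
  obtain W' :: "mat3 \<Rightarrow> mat3 \<Rightarrow>\<^sub>L real" and W'' :: "mat3 \<Rightarrow> mat3 \<Rightarrow>\<^sub>L (mat3 \<Rightarrow>\<^sub>L real)"
    where W': "\<And>E. E \<in> strain_dom \<Longrightarrow> (W has_derivative W' E) (at E within strain_dom)"
      and W'': "\<And>E. E \<in> strain_dom \<Longrightarrow> (W' has_derivative W'' E) (at E within strain_dom)"
    using assms unfolding twice_continuously_differentiable_on_def by blast
  define g where "g X = (\<Sum>b\<in>Basis. W' (sym_part X) (sym_part b) *\<^sub>R b)" for X
  define G where "G X H = (\<Sum>b\<in>Basis. W'' (sym_part X) (sym_part H) (sym_part b) *\<^sub>R b)" for X H
  have lin: "linear (\<lambda>H. L (sym_part H))" for L :: "mat3 \<Rightarrow>\<^sub>L real"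
    by (intro bounded_linear.linear bounded_linear_compose[OF _ bounded_linear_sym_part]
        blinfun.bounded_linear_right)
  have g_inner: "g X \<bullet> H = W' (sym_part X) (sym_part H)" for X H
    unfolding g_def by (rule riesz_inner[OF lin])
  show thesis
  proof
    fix X H
    show "g X \<in> Sym3"
      unfolding Sym3_iff_sym_part
      \<comment> \<open>Tested against any \<open>H\<close>, \<open>sym_part\<close> moves onto
        \<open>H\<close> by self-adjointness, where \<open>g_inner\<close> already applies
        it.\<close>
      by (rule vector_eq_rdot[THEN iffD1]) (simp add: sym_part_inner g_inner)
    show "G X (sym_part H) = G X H"
      by (simp add: G_def)
    assume X: "sym_part X \<in> strain_dom"
    show "((\<lambda>X. W (sym_part X)) has_derivative (\<lambda>H. g X \<bullet> H)) (at X)"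
      unfolding g_inner using has_derivative_sym_part_comp[OF X W'[OF X]] .
    have "((\<lambda>X. \<Sum>b\<in>Basis. W' (sym_part X) (sym_part b) *\<^sub>R b) has_derivative
        (\<lambda>H. \<Sum>b\<in>Basis. W'' (sym_part X) (sym_part H) (sym_part b) *\<^sub>R b)) (at X)"
      using has_derivative_sym_part_comp[OF X W''[OF X]] by (auto intro!: derivative_eq_intros)
    then show "(g has_derivative G X) (at X)"
      by (simp add: g_def[abs_def] G_def[abs_def])
  qed
qed

lemma PK2_stress_eqI:
  assumes E: "E \<in> strain_dom" and "S \<in> Sym3"
    and S: "((\<lambda>X. W (sym_part X)) has_derivative (\<lambda>H. S \<bullet> H)) (at E)"
  shows "PK2_stress W E = S"
  unfolding PK2_stress_def
proof (rule the_equality, intro conjI)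
  have [simp]: "sym_part E = E"
    using E by (simp add: sym_part_Sym3 strain_dom_subset_Sym3)
  show "S \<in> Sym3" by fact
  show "(W has_derivative (\<lambda>H. S \<bullet> H)) (at E within strain_dom)"
    using E S by (rule has_derivative_within_strain_dom)
      (simp add: sym_part_Sym3 strain_dom_subset_Sym3)
  fix S' assume S': "S' \<in> Sym3 \<and> (W has_derivative (\<lambda>H. S' \<bullet> H)) (at E within strain_dom)"
  have "((\<lambda>X. W (sym_part X)) has_derivative (\<lambda>H. S' \<bullet> sym_part H)) (at E)"
    using E S' by (intro has_derivative_sym_part_comp) auto
  then have "((\<lambda>X. W (sym_part X)) has_derivative (\<lambda>H. S' \<bullet> H)) (at E)"
    using S' by (simp add: sym_part_inner[symmetric] sym_part_Sym3)
  from has_derivative_unique[OF this S] show "S' = S"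
    by (metis vector_eq_rdot)
qed

section \<open>Fourth-order tensors as linear maps on matrices\<close>

lemma axis_axis_nth: "axis k (axis l (1::real)) $ i $ j = (if i = k then if j = l then 1 else 0 else 0)"
  by (simp add: axis_def)

text \<open>\<open>axis k (axis l 1)\<close> is the matrix unit with its 1 in position (k, l), so a
  tensor is determined by its action on matrix units.\<close>

lemma tensor_act_axis: "tensor_act \<C> (axis k (axis l 1)) $ i $ j = \<C> $ i $ j $ k $ l"
proof -
  have "tensor_act \<C> (axis k (axis l 1)) $ i $ j
      = (\<Sum>k'\<in>UNIV. if k' = k then \<Sum>l'\<in>UNIV. if l' = l then \<C> $ i $ j $ k $ l else 0 else 0)"
    unfolding tensor_act_def vec_lambda_beta
    by (intro sum.cong refl) (auto simp: axis_axis_nth if_distrib[of "\<lambda>x. a * x" for a] cong: if_cong)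
  also have "\<dots> = \<C> $ i $ j $ k $ l"
    by simp
  finally show ?thesis .
qed

lemma tensor_act_inject: "tensor_act \<C> = tensor_act \<D> \<longleftrightarrow> \<C> = \<D>"
  by (metis tensor_act_axis vec_eq_iff)

lemma linear_tensor_act: "linear (tensor_act \<C>)"
  by (rule linearI)
    (simp_all add: tensor_act_def vec_eq_iff algebra_simps sum.distrib sum_distrib_left)

lemma mat_eq_sum_axis: "(X :: real^'n^'m) = (\<Sum>k\<in>UNIV. \<Sum>l\<in>UNIV. X $ k $ l *\<^sub>R axis k (axis l 1))"
proof -
  have "(\<Sum>k\<in>UNIV. \<Sum>l\<in>UNIV. X $ k $ l *\<^sub>R axis k (axis l (1::real))) $ i $ j
      = (\<Sum>k\<in>UNIV. if k = i then \<Sum>l\<in>UNIV. if l = j then X $ i $ j else 0 else 0)" for i j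
    unfolding sum_component
    by (intro sum.cong refl) (auto simp: axis_axis_nth if_distrib[of "\<lambda>x. a * x" for a] cong: if_cong)
  also have "\<dots> i j = X $ i $ j" for i j
    by simp
  finally show ?thesis
    by (simp add: vec_eq_iff)
qed

lemma tensor_act_surj:
  assumes "linear L"
  obtains \<C> where "tensor_act \<C> = L"
proof
  interpret linear L by fact
  show "tensor_act (\<chi> i j k l. L (axis k (axis l 1)) $ i $ j) = L"
  proof
    fix X
    have "L X = L (\<Sum>k\<in>UNIV. \<Sum>l\<in>UNIV. X $ k $ l *\<^sub>R axis k (axis l 1))"
      by (subst mat_eq_sum_axis) simp
    then show "tensor_act (\<chi> i j k l. L (axis k (axis l 1)) $ i $ j) X = L X"
      by (simp add: tensor_act_def vec_eq_iff sum scale mult.commute)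
  qed
qed

lemma inner_axis_axis: "A \<bullet> axis i (axis j 1) = (A :: real^'n^'m) $ i $ j"
  by (simp add: inner_axis)

section \<open>The stress and the material elasticity tensor\<close>

text \<open>Everything is read off from the extended energy: on \<open>strain_dom\<close> the stress
  is its gradient \<open>g\<close>, and the elasticity tensor at \<open>E\<close> is the component
  form of \<open>G E\<close>.\<close>

lemma
  assumes W: "twice_continuously_differentiable_on W strain_dom" and E: "E \<in> strain_dom"
  shows PK2_stress_Sym3: "PK2_stress W E \<in> Sym3"
    and material_elasticity_has_derivative:
      "(PK2_stress W has_derivative tensor_act (material_elasticity W E)) (at E within strain_dom)"
    and material_elasticity_right_minor: "right_minor_symmetric (material_elasticity W E)"
    and material_elasticity_major: "major_symmetric (material_elasticity W E)"
proof -
  obtain g :: "mat3 \<Rightarrow> mat3" and G :: "mat3 \<Rightarrow> mat3 \<Rightarrow> mat3" where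
    g: "\<And>X. sym_part X \<in> strain_dom \<Longrightarrow> ((\<lambda>X. W (sym_part X)) has_derivative (\<lambda>H. g X \<bullet> H)) (at X)"
    and G: "\<And>X. sym_part X \<in> strain_dom \<Longrightarrow> (g has_derivative G X) (at X)"
    and g_Sym3: "\<And>X. g X \<in> Sym3"
    and G_sym_part: "\<And>X H. G X (sym_part H) = G X H"
    using elastic_potential[OF W] by blast
  have sym [simp]: "sym_part E = E" if "E \<in> strain_dom" for E
    using that by (simp add: sym_part_Sym3 strain_dom_subset_Sym3)
  have PK2: "PK2_stress W E = g E" if "E \<in> strain_dom" for E
    using that g[of E] g_Sym3 by (intro PK2_stress_eqI) auto
  show "PK2_stress W E \<in> Sym3"
    by (simp add: PK2 E g_Sym3)
  have G_E: "(g has_derivative G E) (at E)"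
    using G E by simp
  obtain \<C> where \<C>: "tensor_act \<C> = G E"
    using tensor_act_surj has_derivative_linear[OF G_E] by blast
  have PK2_deriv: "(PK2_stress W has_derivative tensor_act \<C>) (at E within strain_dom)"
    unfolding \<C> using E G_E by (rule has_derivative_within_strain_dom) (simp add: PK2)
  have "material_elasticity W E = \<C>"
    unfolding material_elasticity_def
  proof (rule the_equality, intro conjI allI PK2_deriv)
    show "tensor_act \<C> X = tensor_act \<C> (sym_part X)" for X
      by (simp add: \<C> G_sym_part)
    fix \<D> assume \<D>: "(PK2_stress W has_derivative tensor_act \<D>) (at E within strain_dom) \<and>
        (\<forall>X. tensor_act \<D> X = tensor_act \<D> (sym_part X))"
    \<comment> \<open>Each candidate yields a full derivative of the stress composed with
      \<open>sym_part\<close>; the extension condition absorbs the projection of the increment, so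
      uniqueness at \<open>E\<close> identifies the candidates.\<close>
    have "((\<lambda>X. PK2_stress W (sym_part X)) has_derivative tensor_act \<F>) (at E)"
      if "(PK2_stress W has_derivative tensor_act \<F>) (at E within strain_dom)"
        "\<And>X. tensor_act \<F> (sym_part X) = tensor_act \<F> X" for \<F>
      using has_derivative_sym_part_comp[of E "PK2_stress W" "tensor_act \<F>"] E that by simp
    from has_derivative_unique[OF this[of \<D>] this[of \<C>]] \<D> PK2_deriv
    show "\<D> = \<C>"
      by (simp add: \<C> G_sym_part tensor_act_inject[symmetric])
  qed
  note \<C>_eq = this
  show "(PK2_stress W has_derivative tensor_act (material_elasticity W E)) (at E within strain_dom)"
    by (simp add: \<C>_eq PK2_deriv)
  have major: "G E u \<bullet> v = G E v \<bullet> u" for u v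
    using open_sym_part_vimage_strain_dom _ _ G_E
  proof (rule second_derivative_symmetric)
    show "E \<in> sym_part -` strain_dom" using E by simp
    show "((\<lambda>X. W (sym_part X)) has_derivative (\<lambda>H. g y \<bullet> H)) (at y)"
      if "y \<in> sym_part -` strain_dom" for y
      using g that by simp
  qed
  show "major_symmetric (material_elasticity W E)"
    unfolding major_symmetric_def \<C>_eq
    \<comment> \<open>With matrix units for \<open>u\<close> and \<open>v\<close>,
      \<open>G E u \<bullet> v\<close> is a single component of \<open>\<C>\<close>.\<close>
    by (metis major \<C> tensor_act_axis inner_axis_axis)
  \<comment> \<open>Matrix units with exchanged indices have the same symmetric part, which is all
    that \<open>G E\<close> sees.\<close>
  have "sym_part (axis k (axis l 1)) = sym_part (axis l (axis k 1))" for k l :: 3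
    by (simp add: sym_part_def vec_eq_iff transpose_def axis_def)
  then show "right_minor_symmetric (material_elasticity W E)"
    unfolding right_minor_symmetric_def \<C>_eq
    by (metis G_sym_part \<C> tensor_act_axis)
qed

section \<open>Tensor algebra and the push-forward\<close>

text \<open>Exchange the pairs, swap within the last pair, and exchange back: ijkl, klij, klji,
  jikl.\<close>

lemma left_minor_symmetric_from_right_and_major:
  "right_minor_symmetric \<T> \<Longrightarrow> major_symmetric \<T> \<Longrightarrow> left_minor_symmetric \<T>"
  unfolding right_minor_symmetric_def major_symmetric_def left_minor_symmetric_def by metis

lemma tensor_act_add: "tensor_act (\<C> + \<D>) Z = tensor_act \<C> Z + tensor_act \<D> Z"
  by (simp add: tensor_act_def vec_eq_iff algebra_simps sum.distrib)

text \<open>For symmetric \<open>Z\<close> and \<open>\<tau>\<close>, each of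
  \<open>sym_tprod (mat 1) \<tau>\<close> and \<open>sym_tprod \<tau> (mat 1)\<close> thus
  contributes half of \<open>Z ** \<tau> + \<tau> ** Z\<close>.\<close>

lemma tensor_act_sym_tprod:
  "tensor_act (sym_tprod P Q) Z =
     (1/2) *\<^sub>R (P ** Z ** transpose Q + Q ** transpose Z ** transpose P)"
proof -
  have "(\<Sum>k\<in>UNIV. \<Sum>l\<in>UNIV. P $ i $ k * Q $ j $ l * Z $ k $ l) = (P ** Z ** transpose Q) $ i $ j"
    for i j
    by (subst sum.swap)
      (simp add: matrix_matrix_mult_def transpose_def sum_distrib_left sum_distrib_right mult_ac)
  moreover have "(\<Sum>k\<in>UNIV. \<Sum>l\<in>UNIV. Q $ i $ l * P $ j $ k * Z $ k $ l)
      = (Q ** transpose Z ** transpose P) $ i $ j" for i j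
    by (simp add: matrix_matrix_mult_def transpose_def sum_distrib_left sum_distrib_right mult_ac)
  ultimately show ?thesis
    by (simp add: tensor_act_def sym_tprod_def vec_eq_iff algebra_simps add_divide_distrib
        sum.distrib sum_divide_distrib[symmetric])
qed

text \<open>Applied to the material elasticity tensor this is J c, so the factor 1/J never enters
  the computations.\<close>

definition push_forward :: "mat3 \<Rightarrow> tensor4 \<Rightarrow> tensor4" where
  "push_forward F \<C> = (\<chi> i j k l. \<Sum>I\<in>UNIV. \<Sum>J\<in>UNIV. \<Sum>K\<in>UNIV. \<Sum>L\<in>UNIV.
     F $ i $ I * F $ j $ J * \<C> $ I $ J $ K $ L * F $ k $ K * F $ l $ L)"

lemma det_scaleR_spatial_elasticity:
  assumes "det F > 0"
  shows "det F *\<^sub>R spatial_elasticity W F = push_forward F (material_elasticity W (green_lagrange F))"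
  using assms by (simp add: spatial_elasticity_def push_forward_def vec_eq_iff)

lemma sum_swap_pairs:
  "(\<Sum>a\<in>A. \<Sum>b\<in>B. \<Sum>c\<in>C. \<Sum>d\<in>D. f a b c d :: 'a::comm_monoid_add)
    = (\<Sum>c\<in>C. \<Sum>d\<in>D. \<Sum>a\<in>A. \<Sum>b\<in>B. f a b c d)"
proof -
  have "(\<Sum>x\<in>A \<times> B. \<Sum>y\<in>C \<times> D. f (fst x) (snd x) (fst y) (snd y))
      = (\<Sum>y\<in>C \<times> D. \<Sum>x\<in>A \<times> B. f (fst x) (snd x) (fst y) (snd y))"
    by (rule sum.swap)
  then show ?thesis
    by (simp add: sum.cartesian_product')
qed

lemma push_forward_right_minor:
  "right_minor_symmetric \<C> \<Longrightarrow> right_minor_symmetric (push_forward F \<C>)"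
  unfolding right_minor_symmetric_def
proof (intro allI)
  fix i j k l
  assume \<C>: "\<forall>i j k l. \<C> $ i $ j $ k $ l = \<C> $ i $ j $ l $ k"
  have "push_forward F \<C> $ i $ j $ k $ l =
      (\<Sum>I\<in>UNIV. \<Sum>J\<in>UNIV. \<Sum>L\<in>UNIV. \<Sum>K\<in>UNIV.
        F $ i $ I * F $ j $ J * \<C> $ I $ J $ K $ L * F $ k $ K * F $ l $ L)"
    unfolding push_forward_def vec_lambda_beta by (intro sum.cong refl sum.swap)
  also have "\<dots> = push_forward F \<C> $ i $ j $ l $ k"
    unfolding push_forward_def vec_lambda_beta
    by (intro sum.cong refl) (subst \<C>[rule_format], simp)
  finally show "push_forward F \<C> $ i $ j $ k $ l = push_forward F \<C> $ i $ j $ l $ k" .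
qed

lemma push_forward_major:
  "major_symmetric \<C> \<Longrightarrow> major_symmetric (push_forward F \<C>)"
  unfolding major_symmetric_def push_forward_def
  by (simp, intro allI, subst sum_swap_pairs) (simp add: mult_ac)

text \<open>The two factors of \<open>F\<close> contracted with \<open>Z\<close> pull it back to
  \<open>transpose F ** Z ** F\<close>; the other two push the result forward. For
  \<open>Z = D\<close> the pulled-back matrix is the strain rate.\<close>

lemma tensor_act_push_forward:
  "tensor_act (push_forward F \<C>) Z
    = F ** tensor_act \<C> (transpose F ** Z ** F) ** transpose F"
proof -
  have "tensor_act (push_forward F \<C>) Z $ i $ j
    = (F ** tensor_act \<C> (transpose F ** Z ** F) ** transpose F) $ i $ j" for i j
  proof -
    \<comment> \<open>The sums are reordered to J, I, K, L, l, k, the nesting produced by expanding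
      the matrix products on the right-hand side.\<close>
    have "tensor_act (push_forward F \<C>) Z $ i $ j =
      (\<Sum>k\<in>UNIV. \<Sum>l\<in>UNIV. \<Sum>I\<in>UNIV. \<Sum>J\<in>UNIV. \<Sum>K\<in>UNIV. \<Sum>L\<in>UNIV.
         F $ i $ I * F $ j $ J * \<C> $ I $ J $ K $ L * F $ k $ K * F $ l $ L * Z $ k $ l)"
      by (simp add: tensor_act_def push_forward_def sum_distrib_right)
    also have "\<dots> = (\<Sum>I\<in>UNIV. \<Sum>J\<in>UNIV. \<Sum>k\<in>UNIV. \<Sum>l\<in>UNIV. \<Sum>K\<in>UNIV. \<Sum>L\<in>UNIV.
         F $ i $ I * F $ j $ J * \<C> $ I $ J $ K $ L * F $ k $ K * F $ l $ L * Z $ k $ l)"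
      by (rule sum_swap_pairs)
    also have "\<dots> = (\<Sum>I\<in>UNIV. \<Sum>J\<in>UNIV. \<Sum>K\<in>UNIV. \<Sum>L\<in>UNIV. \<Sum>k\<in>UNIV. \<Sum>l\<in>UNIV.
         F $ i $ I * F $ j $ J * \<C> $ I $ J $ K $ L * F $ k $ K * F $ l $ L * Z $ k $ l)"
      by (intro sum.cong refl sum_swap_pairs)
    also have "\<dots> = (\<Sum>I\<in>UNIV. \<Sum>J\<in>UNIV. \<Sum>K\<in>UNIV. \<Sum>L\<in>UNIV. \<Sum>l\<in>UNIV. \<Sum>k\<in>UNIV.
         F $ i $ I * F $ j $ J * \<C> $ I $ J $ K $ L * F $ k $ K * F $ l $ L * Z $ k $ l)"
      by (intro sum.cong refl sum.swap)
    also have "\<dots> = (\<Sum>J\<in>UNIV. \<Sum>I\<in>UNIV. \<Sum>K\<in>UNIV. \<Sum>L\<in>UNIV. \<Sum>l\<in>UNIV. \<Sum>k\<in>UNIV.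
         F $ i $ I * F $ j $ J * \<C> $ I $ J $ K $ L * F $ k $ K * F $ l $ L * Z $ k $ l)"
      by (rule sum.swap)
    also have "\<dots> = (F ** tensor_act \<C> (transpose F ** Z ** F) ** transpose F) $ i $ j"
      by (simp add: tensor_act_def matrix_matrix_mult_def transpose_def sum_distrib_left
          sum_distrib_right mult_ac)
    finally show ?thesis .
  qed
  then show ?thesis by (simp add: vec_eq_iff)
qed

section \<open>Strain and stress along a motion\<close>

text \<open>Here 1 + 2E is \<open>transpose F ** F\<close>, whose quadratic form is the squared norm
  of \<open>F *v x\<close>, and \<open>F\<close> is injective.\<close>

lemma green_lagrange_in_strain_dom:
  assumes "det F > 0"
  shows "green_lagrange F \<in> strain_dom"
proof -
  have "x \<bullet> ((transpose F ** F) *v x) > 0" if "x \<noteq> 0" for x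
  proof -
    have "F *v x \<noteq> 0"
      using assms that matrix_left_invertible_ker[of F] invertible_det_nz[of F] invertible_left_inverse[of F]
      by auto
    then have "(F *v x) \<bullet> (F *v x) > 0"
      by simp
    then show ?thesis
      by (simp add: matrix_vector_mul_assoc[symmetric] transpose_matrix_vector
          inner_commute[of x] dot_lmul_matrix)
  qed
  moreover have "green_lagrange F \<in> Sym3"
    by (simp add: green_lagrange_def Sym3_def vec_eq_iff transpose_def matrix_matrix_mult_def mat_def
        mult.commute)
  ultimately show ?thesis
    by (simp add: strain_dom_def green_lagrange_def)
qed

lemma kirchhoff_stress_transpose:
  "PK2_stress W (green_lagrange F) \<in> Sym3 \<Longrightarrow> transpose (kirchhoff_stress W F) = kirchhoff_stress W F"
  by (simp add: kirchhoff_stress_def Sym3_def matrix_transpose_mul matrix_mul_assoc)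

lemma ZJ_stiffness_act:
  assumes "det F > 0" "transpose \<tau> = \<tau>" "transpose Z = Z" and \<tau>: "\<tau> = kirchhoff_stress W F"
  shows "tensor_act (ZJ_stiffness W F) Z =
    F ** tensor_act (material_elasticity W (green_lagrange F)) (transpose F ** Z ** F) ** transpose F
      + Z ** \<tau> + \<tau> ** Z"
  unfolding ZJ_stiffness_def tensor_act_add det_scaleR_spatial_elasticity[OF assms(1)]
    tensor_act_push_forward tensor_act_sym_tprod \<tau>[symmetric] assms(2,3) transpose_mat
    matrix_mul_lid matrix_mul_rid
  by (simp add: vec_eq_iff field_simps)

lemma green_lagrange_has_vector_derivative:
  assumes "(F has_vector_derivative F') (at t within T)"
  shows "((\<lambda>s. green_lagrange (F s)) has_vector_derivative
    (1/2) *\<^sub>R (transpose F' ** F t + transpose (F t) ** F')) (at t within T)"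
  unfolding green_lagrange_def
  using bounded_bilinear.has_vector_derivative[OF bounded_bilinear_matrix_matrix_mult
      bounded_linear.has_vector_derivative[OF bounded_linear_transpose assms] assms]
  by (auto intro!: derivative_eq_intros simp: add.commute)

lemma kirchhoff_stress_has_vector_derivative:
  assumes W: "twice_continuously_differentiable_on W strain_dom"
    and T: "open T" "t \<in> T" "\<And>s. s \<in> T \<Longrightarrow> det (F s) > 0"
    and F: "(F has_vector_derivative F') (at t)"
  defines "S \<equiv> PK2_stress W (green_lagrange (F t))"
  shows "((\<lambda>s. kirchhoff_stress W (F s)) has_vector_derivative
    F' ** S ** transpose (F t)
      + F t ** tensor_act (material_elasticity W (green_lagrange (F t)))
          ((1/2) *\<^sub>R (transpose F' ** F t + transpose (F t) ** F')) ** transpose (F t)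
      + F t ** S ** transpose F') (at t)"
proof -
  let ?E = "\<lambda>s. green_lagrange (F s)"
  let ?E' = "(1/2) *\<^sub>R (transpose F' ** F t + transpose (F t) ** F')"
  note F_T = has_vector_derivative_at_within[OF F, of T]
  \<comment> \<open>The stress is differentiable only relative to \<open>strain_dom\<close>, so the
    chain rule is applied within \<open>T\<close>, whose strains stay in that set; openness of
    \<open>T\<close> removes the restriction afterwards.\<close>
  have "(PK2_stress W has_derivative tensor_act (material_elasticity W (?E t))) (at (?E t) within ?E ` T)"
    using W T
    by (intro has_derivative_subset[OF material_elasticity_has_derivative])
      (auto intro: green_lagrange_in_strain_dom)
  from has_derivative_in_compose
    [OF green_lagrange_has_vector_derivative[OF F_T, unfolded has_vector_derivative_def] this]
  have "((\<lambda>s. PK2_stress W (?E s)) has_vector_derivative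
      tensor_act (material_elasticity W (?E t)) ?E') (at t within T)"
    by (simp add: has_vector_derivative_def linear_cmul[OF linear_tensor_act])
  then have PK2: "((\<lambda>s. PK2_stress W (?E s)) has_vector_derivative
      tensor_act (material_elasticity W (?E t)) ?E') (at t)"
    by (simp add: at_within_open[OF T(2,1)])
  note mult = bounded_bilinear.has_vector_derivative[OF bounded_bilinear_matrix_matrix_mult]
  show ?thesis
    using mult[OF mult[OF F PK2] bounded_linear.has_vector_derivative[OF bounded_linear_transpose F]]
    unfolding kirchhoff_stress_def S_def
    by (simp add: algebra_simps bounded_bilinear.add_left[OF bounded_bilinear_matrix_matrix_mult])
qed

lemma sym_part_skew_part:
  "X = sym_part X + skew_part X" "transpose X = sym_part X - skew_part X"
  by (simp_all add: sym_part_def skew_part_def vec_eq_iff field_simps)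

lemma ZJ_rate_kirchhoff_stress:
  assumes W: "twice_continuously_differentiable_on W strain_dom"
    and motion: "is_motion_on T F" and t: "t \<in> T"
  shows "(\<lambda>s. kirchhoff_stress W (F s)) differentiable (at t)"
    and "ZJ_rate F (\<lambda>s. kirchhoff_stress W (F s)) t
          = tensor_act (ZJ_stiffness W (F t)) (stretching F t)"
proof -
  have T: "open T" "\<And>s. s \<in> T \<Longrightarrow> det (F s) > 0"
    using motion by (auto simp: is_motion_on_def)
  define F' where "F' = vector_derivative F (at t)"
  have F: "(F has_vector_derivative F') (at t)"
    using motion t unfolding is_motion_on_def F'_def C1_differentiable_on_eq
    by (auto simp: vector_derivative_works)
  define L D V \<tau> where "L = velocity_gradient F t" and "D = stretching F t"
    and "V = vorticity F t" and "\<tau> = kirchhoff_stress W (F t)"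
  let ?C = "tensor_act (material_elasticity W (green_lagrange (F t)))"
  have "invertible (F t)"
    using T t by (simp add: invertible_det_nz less_imp_neq[symmetric])
  then have "matrix_inv (F t) ** F t = mat 1"
    unfolding invertible_def matrix_inv_def by (rule someI2_ex) simp
  then have F': "F' = L ** F t"
    by (simp add: L_def velocity_gradient_def F'_def matrix_mul_assoc[symmetric])
  have L: "L = D + V" "transpose L = D - V"
    unfolding L_def D_def V_def stretching_def vorticity_def by (rule sym_part_skew_part)+
  have D: "transpose D = D"
    unfolding D_def stretching_def using sym_part_in_Sym3 by (simp add: Sym3_def)
  have \<tau>: "transpose \<tau> = \<tau>"
    unfolding \<tau>_def
    using T t by (intro kirchhoff_stress_transpose PK2_stress_Sym3[OF W] green_lagrange_in_strain_dom)
  \<comment> \<open>The spin drops out of the strain rate because \<open>transpose L + L\<close> is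
    twice \<open>D\<close>.\<close>
  have E': "(1/2) *\<^sub>R (transpose F' ** F t + transpose (F t) ** F') = transpose (F t) ** D ** F t"
  proof -
    have "transpose F' ** F t + transpose (F t) ** F'
        = transpose (F t) ** (transpose L + L) ** F t"
      by (simp add: F' matrix_transpose_mul matrix_mul_assoc matrix_add_ldistrib
          bounded_bilinear.add_left[OF bounded_bilinear_matrix_matrix_mult])
    also have "transpose L + L = 2 *\<^sub>R D"
      unfolding L(2) by (simp add: L(1) scaleR_2)
    finally show ?thesis
      by (simp add: bounded_bilinear.scaleR_left[OF bounded_bilinear_matrix_matrix_mult]
          bounded_bilinear.scaleR_right[OF bounded_bilinear_matrix_matrix_mult])
  qed
  have \<tau>': "((\<lambda>s. kirchhoff_stress W (F s)) has_vector_derivative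
      L ** \<tau> + F t ** ?C (transpose (F t) ** D ** F t) ** transpose (F t) + \<tau> ** transpose L) (at t)"
    using kirchhoff_stress_has_vector_derivative[OF W T(1) t T(2) F]
    \<comment> \<open>The order matters: the left-hand side of \<open>E'\<close> mentions
      \<open>F'\<close>, so it must be rewritten before \<open>F'\<close> is replaced by
      \<open>L ** F t\<close>.\<close>
    unfolding E' unfolding F'
    by (simp add: \<tau>_def kirchhoff_stress_def matrix_transpose_mul matrix_mul_assoc)
  then show "(\<lambda>s. kirchhoff_stress W (F s)) differentiable (at t)"
    by (rule differentiableI_vector)
  show "ZJ_rate F (\<lambda>s. kirchhoff_stress W (F s)) t
      = tensor_act (ZJ_stiffness W (F t)) (stretching F t)"
    \<comment> \<open>With \<open>L = D + V\<close> and \<open>transpose L = D - V\<close>, the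
      terms \<open>V ** \<tau>\<close> and \<open>\<tau> ** V\<close> from the stress rate cancel
      against the corotational terms, leaving \<open>D ** \<tau> + \<tau> ** D\<close>. The
      transpose is replaced first, since it contains \<open>L\<close>.\<close>
    unfolding ZJ_rate_def vector_derivative_at[OF \<tau>'] D_def[symmetric] V_def[symmetric] \<tau>_def[symmetric]
      ZJ_stiffness_act[OF T(2)[OF t] \<tau> D \<tau>_def] L(2)
    unfolding L(1)
    by (simp add: bounded_bilinear.add_left[OF bounded_bilinear_matrix_matrix_mult]
        bounded_bilinear.diff_right[OF bounded_bilinear_matrix_matrix_mult])
qed

section \<open>Symmetries of the stiffness\<close>

text \<open>Swapping k and l exchanges the two products. Exchanging the pairs ij and kl turns the
  second term of each product into the second term of the other and fixes the first terms. Hence the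
  symmetries belong to the sum.\<close>

lemma sym_tprod_mat_1_symmetries:
  assumes "transpose \<tau> = \<tau>"
  defines "\<T> \<equiv> sym_tprod (mat 1) \<tau> + sym_tprod \<tau> (mat 1)"
  shows "major_symmetric \<T>" "right_minor_symmetric \<T>"
proof -
  have "\<tau> $ i $ j = \<tau> $ j $ i" for i j
    using arg_cong[OF assms(1), of "\<lambda>A. A $ j $ i"] by (simp add: transpose_def)
  moreover have "mat 1 $ i $ j = (mat 1 $ j $ i :: real)" for i j :: 3
    by (auto simp: mat_def)
  ultimately show "major_symmetric \<T>" "right_minor_symmetric \<T>"
    unfolding major_symmetric_def right_minor_symmetric_def \<T>_def sym_tprod_def
    by (simp_all add: field_simps)
qed

lemma major_symmetric_add:
  "major_symmetric \<S> \<Longrightarrow> major_symmetric \<T> \<Longrightarrow> major_symmetric (\<S> + \<T>)"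
  by (simp add: major_symmetric_def)

lemma right_minor_symmetric_add:
  "right_minor_symmetric \<S> \<Longrightarrow> right_minor_symmetric \<T> \<Longrightarrow> right_minor_symmetric (\<S> + \<T>)"
  by (simp add: right_minor_symmetric_def)

lemma ZJ_stiffness_symmetries:
  assumes W: "twice_continuously_differentiable_on W strain_dom" and "det F > 0"
  shows "major_symmetric (ZJ_stiffness W F)" "left_minor_symmetric (ZJ_stiffness W F)"
    "right_minor_symmetric (ZJ_stiffness W F)"
proof -
  let ?\<tau> = "kirchhoff_stress W F"
  note E = green_lagrange_in_strain_dom[OF \<open>det F > 0\<close>]
  note c = push_forward_major[OF material_elasticity_major[OF W E], of F]
    push_forward_right_minor[OF material_elasticity_right_minor[OF W E], of F]
  note geometric = sym_tprod_mat_1_symmetries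
    [OF kirchhoff_stress_transpose[OF PK2_stress_Sym3[OF W E]]]
  \<comment> \<open>The geometric terms are bracketed together, since only their sum is known to be
    symmetric.\<close>
  have stiffness: "ZJ_stiffness W F = push_forward F (material_elasticity W (green_lagrange F))
      + (sym_tprod (mat 1) ?\<tau> + sym_tprod ?\<tau> (mat 1))"
    by (simp add: ZJ_stiffness_def det_scaleR_spatial_elasticity[OF \<open>det F > 0\<close>] add.assoc)
  show major: "major_symmetric (ZJ_stiffness W F)"
    unfolding stiffness by (intro major_symmetric_add c geometric)
  show right: "right_minor_symmetric (ZJ_stiffness W F)"
    unfolding stiffness by (intro right_minor_symmetric_add c geometric)
  show "left_minor_symmetric (ZJ_stiffness W F)"
    using right major by (rule left_minor_symmetric_from_right_and_major)
qed

theorem mainTheorem2: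
  fixes W :: "mat3 \<Rightarrow> real"
  assumes "twice_continuously_differentiable_on W strain_dom"
  shows "(\<forall>T F. is_motion_on T F \<longrightarrow> (\<forall>t\<in>T.
           (\<lambda>s. kirchhoff_stress W (F s)) differentiable (at t) \<and>
           ZJ_rate F (\<lambda>s. kirchhoff_stress W (F s)) t
             = tensor_act (ZJ_stiffness W (F t)) (stretching F t))) \<and>
         (\<forall>F :: mat3. det F > 0 \<longrightarrow>
           (let \<tau> = kirchhoff_stress W F; \<delta> = (mat 1 :: mat3) in
             \<forall>i j k l. ZJ_stiffness W F $ i $ j $ k $ l
               = det F * spatial_elasticity W F $ i $ j $ k $ l
                 + (1/2) * (\<delta> $ i $ k * \<tau> $ j $ l + \<tau> $ i $ l * \<delta> $ j $ k)
                 + (1/2) * (\<tau> $ i $ k * \<delta> $ j $ l + \<delta> $ i $ l * \<tau> $ j $ k)) \<and>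
           major_symmetric (ZJ_stiffness W F) \<and>
           left_minor_symmetric (ZJ_stiffness W F) \<and>
           right_minor_symmetric (ZJ_stiffness W F))"
proof (intro conjI allI impI ballI)
  fix T F t assume "is_motion_on T F" "t \<in> T"
  then show "(\<lambda>s. kirchhoff_stress W (F s)) differentiable (at t)"
    and "ZJ_rate F (\<lambda>s. kirchhoff_stress W (F s)) t
          = tensor_act (ZJ_stiffness W (F t)) (stretching F t)"
    by (rule ZJ_rate_kirchhoff_stress[OF assms])+
next
  fix F :: mat3 assume "det F > 0"
  then show "major_symmetric (ZJ_stiffness W F)" "left_minor_symmetric (ZJ_stiffness W F)"
    "right_minor_symmetric (ZJ_stiffness W F)"
    by (rule ZJ_stiffness_symmetries[OF assms])+
qed (simp add: ZJ_stiffness_def sym_tprod_def Let_def)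

end
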